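(* The Bass stable rank of the Bohl algebra $\mathrm{B}$ is infinite, i.e. $\operatorname{bsr} \mathrm{B}=\infty$.
   Context: Let $\mathbb{N}=\{0,1,2,\dots\}$ and $\mathbb{N}^*=\{1,2,3,\dots\}$. The Bohl algebra $\mathrm{B}$ is the complex algebra of functions $\mathbb{R}\to\mathbb{C}$ given by $$\mathrm{B}:=\Big\{ t\mapsto\sum_{n=1}^N c_n t^{m_n} e^{\lambda_n t}: N\in \mathbb{N}^*,\; c_n, \lambda_n \in \mathbb{C}, \; m_n \in \mathbb{N}\Big\},$$ with pointwise addition, scalar multiplication and multiplication. Let $R$ be a commutative unital ring with identity $1\neq 0$. For $n\in\mathbb{N}^*$, an $n$-tuple $(f_1,\dots,f_n)\in R^n$ is called invertible if there exists $(x_1,\dots,x_n)\in R^n$ with $\sum_{j=1}^n x_jf_j=1$; the set of all invertible $n$-tuples is denoted $U_n(R)$. An $(n+1)$-tuple $(f_1,\dots,f_n,g)\in U_{n+1}(R)$ is called reducible if there exists $(a_1,\dots,a_n)\in R^n$ such that $(f_1+a_1g,\dots, f_n+a_ng)\in U_n(R)$. The Bass stable rank $\operatorname{bsr} R$ of $R$ is the smallest integer $n\geq 1$ such that every element of $U_{n+1}(R)$ is reducible; if no such $n$ exists, then $\operatorname{bsr} R=\infty$. *)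

theory Defs
  imports Complex_Main "HOL-Algebra.Ring" "HOL-Library.FuncSet" "HOL-Library.Extended_Nat"
begin

text \<open>An \<open>n\<close>-tuple over a ring \<open>R\<close> is an extensional function on \<open>{1..n}\<close> with values in
  the carrier of \<open>R\<close>. In an \<open>n+1\<close>-tuple, the entry at \<open>Suc n\<close> plays the role of \<open>g\<close> in
  \<open>(f\<^sub>1, \<dots>, f\<^sub>n, g)\<close>.\<close>

definition tuples :: "('a, 'b) ring_scheme \<Rightarrow> nat \<Rightarrow> (nat \<Rightarrow> 'a) set" where
  "tuples R n = {1..n} \<rightarrow>\<^sub>E carrier R"

definition invertible_tuples :: "('a, 'b) ring_scheme \<Rightarrow> nat \<Rightarrow> (nat \<Rightarrow> 'a) set" where
  "invertible_tuples R n =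
     {f \<in> tuples R n. \<exists>x \<in> tuples R n. (\<Oplus>\<^bsub>R\<^esub>j\<in>{1..n}. x j \<otimes>\<^bsub>R\<^esub> f j) = \<one>\<^bsub>R\<^esub>}"

definition reducible_tuple :: "('a, 'b) ring_scheme \<Rightarrow> nat \<Rightarrow> (nat \<Rightarrow> 'a) \<Rightarrow> bool" where
  "reducible_tuple R n f \<longleftrightarrow>
     (\<exists>a \<in> tuples R n.
        (\<lambda>j\<in>{1..n}. f j \<oplus>\<^bsub>R\<^esub> a j \<otimes>\<^bsub>R\<^esub> f (Suc n)) \<in> invertible_tuples R n)"

definition stable_at :: "('a, 'b) ring_scheme \<Rightarrow> nat \<Rightarrow> bool" where
  "stable_at R n \<longleftrightarrow> (\<forall>f \<in> invertible_tuples R (Suc n). reducible_tuple R n f)"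

definition bass_stable_rank :: "('a, 'b) ring_scheme \<Rightarrow> enat" where
  "bass_stable_rank R =
     (if \<exists>n\<ge>1. stable_at R n then enat (LEAST n. n \<ge> 1 \<and> stable_at R n) else \<infinity>)"

definition bohl_functions :: "(real \<Rightarrow> complex) set" where
  "bohl_functions =
     {(\<lambda>t. \<Sum>n=1..N. c n * of_real t ^ m n * exp (l n * of_real t)) | N c m l. N \<ge> (1::nat)}"

text \<open>Only the ring structure of the Bohl algebra enters the Bass stable rank, so the scalar
  multiplication is not part of the record.\<close>

definition bohl_algebra :: "(real \<Rightarrow> complex) ring" where
  "bohl_algebra =
     \<lparr>carrier = bohl_functions,
      monoid.mult = (\<lambda>f g t. f t * g t), one = (\<lambda>t. 1),
      ring.zero = (\<lambda>t. 0), add = (\<lambda>f g t. f t + g t)\<rparr>"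

lemma bohl_functionsI:
  fixes N :: nat
  assumes "N \<ge> 1" "\<And>t. f t = (\<Sum>n=1..N. c n * of_real t ^ m n * exp (l n * of_real t))"
  shows "f \<in> bohl_functions"
proof -
  have "f = (\<lambda>t. \<Sum>n=1..N. c n * of_real t ^ m n * exp (l n * of_real t))"
    using assms(2) by (rule ext)
  then show ?thesis
    using assms(1) unfolding bohl_functions_def mem_Collect_eq by blast
qed

lemma bohl_functionsE:
  assumes "f \<in> bohl_functions"
  obtains N c m l where "N \<ge> (1::nat)"
    "f = (\<lambda>t. \<Sum>n=1..N. c n * of_real t ^ m n * exp (l n * of_real t))"
  using assms unfolding bohl_functions_def mem_Collect_eq by blast

lemma bohl_functions_monomial:
  "(\<lambda>t. c * of_real t ^ m * exp (l * of_real t)) \<in> bohl_functions"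
  by (rule bohl_functionsI[of 1 _ "\<lambda>_. c" "\<lambda>_. m" "\<lambda>_. l"]) simp_all

lemma bohl_functions_add:
  assumes "f \<in> bohl_functions" "g \<in> bohl_functions"
  shows "(\<lambda>t. f t + g t) \<in> bohl_functions"
proof -
  obtain N c m l where f: "f = (\<lambda>t. \<Sum>n=1..N. c n * of_real t ^ m n * exp (l n * of_real t))"
    and N: "N \<ge> (1::nat)"
    using assms(1) by (rule bohl_functionsE)
  obtain N' :: nat and c' m' l' where
    g: "g = (\<lambda>t. \<Sum>n=1..N'. c' n * of_real t ^ m' n * exp (l' n * of_real t))"
    using assms(2) by (rule bohl_functionsE)
  define C where "C n = (if n \<le> N then c n else c' (n - N))" for n
  define M where "M n = (if n \<le> N then m n else m' (n - N))" for n
  define L where "L n = (if n \<le> N then l n else l' (n - N))" for n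
  have "f t + g t = (\<Sum>n=1..N+N'. C n * of_real t ^ M n * exp (L n * of_real t))" for t
  proof -
    let ?h = "\<lambda>n. C n * of_real t ^ M n * exp (L n * of_real t)"
    have "sum ?h {1..N+N'} = sum ?h {1..N} + sum ?h {N+1..N+N'}"
      by (rule sum.ub_add_nat) simp
    also have "sum ?h {1..N} = f t"
      unfolding f C_def M_def L_def by (rule sum.cong) auto
    also have "sum ?h {N+1..N+N'} = (\<Sum>n=1..N'. ?h (n + N))"
      using sum.shift_bounds_cl_nat_ivl[of ?h 1 N N'] by (simp add: add.commute)
    also have "\<dots> = g t"
      unfolding g C_def M_def L_def by (rule sum.cong) auto
    finally show ?thesis by simp
  qed
  moreover have "N + N' \<ge> 1" using N by simp
  ultimately show ?thesis
    by (intro bohl_functionsI[of "N + N'" _ C M L])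
qed

lemma bohl_functions_sum:
  assumes "finite A" "\<And>i. i \<in> A \<Longrightarrow> f i \<in> bohl_functions"
  shows "(\<lambda>t. \<Sum>i\<in>A. f i t) \<in> bohl_functions"
  using assms
proof (induction A rule: finite_induct)
  case empty
  show ?case using bohl_functions_monomial[of 0 0 0] by simp
next
  case (insert x A)
  then show ?case by (simp add: bohl_functions_add)
qed

lemma bohl_functions_mult:
  assumes "f \<in> bohl_functions" "g \<in> bohl_functions"
  shows "(\<lambda>t. f t * g t) \<in> bohl_functions"
proof -
  obtain N :: nat and c m l where
    f: "f = (\<lambda>t. \<Sum>n=1..N. c n * of_real t ^ m n * exp (l n * of_real t))"
    using assms(1) by (rule bohl_functionsE)
  obtain N' :: nat and c' m' l' where
    g: "g = (\<lambda>t. \<Sum>n=1..N'. c' n * of_real t ^ m' n * exp (l' n * of_real t))"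
    using assms(2) by (rule bohl_functionsE)
  have "f t * g t = (\<Sum>i=1..N. \<Sum>j=1..N'.
      (c i * c' j) * of_real t ^ (m i + m' j) * exp ((l i + l' j) * of_real t))" for t
    unfolding f g sum_product
    by (intro sum.cong refl) (simp add: power_add exp_add algebra_simps)
  moreover have "(\<lambda>t. \<Sum>i=1..N. \<Sum>j=1..N'.
      (c i * c' j) * of_real t ^ (m i + m' j) * exp ((l i + l' j) * of_real t))
      \<in> bohl_functions"
    by (intro bohl_functions_sum bohl_functions_monomial) auto
  ultimately show ?thesis by presburger
qed

lemma bohl_functions_const: "(\<lambda>t. c) \<in> bohl_functions"
  using bohl_functions_monomial[of c 0 0] by simp

lemma cring_bohl_algebra: "cring bohl_algebra"
proof (rule cringI)
  show "abelian_group bohl_algebra"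
  proof (rule abelian_groupI)
    fix f assume "f \<in> carrier bohl_algebra"
    then have "(\<lambda>t. - f t) \<in> bohl_functions"
      using bohl_functions_mult[OF bohl_functions_const[of "-1"]]
      by (simp add: bohl_algebra_def)
    then show "\<exists>g \<in> carrier bohl_algebra. g \<oplus>\<^bsub>bohl_algebra\<^esub> f = \<zero>\<^bsub>bohl_algebra\<^esub>"
      by (intro bexI[of _ "\<lambda>t. - f t"]) (auto simp: bohl_algebra_def)
  qed (auto simp: bohl_algebra_def bohl_functions_add bohl_functions_const add_ac)
  show "comm_monoid bohl_algebra"
    by (rule comm_monoidI)
      (auto simp: bohl_algebra_def bohl_functions_mult bohl_functions_const mult_ac)
qed (auto simp: bohl_algebra_def algebra_simps)

lemma bohl_algebra_one_neq_zero: "\<one>\<^bsub>bohl_algebra\<^esub> \<noteq> \<zero>\<^bsub>bohl_algebra\<^esub>"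
  by (auto simp: bohl_algebra_def fun_eq_iff)

end

theory Submission
  imports Defs "HOL-Homology.Homology" "HOL-Library.Poly_Mapping"
    "HOL-Computational_Algebra.Polynomial" "HOL-Analysis.Derivative"
begin

text \<open>
  The Bohl algebra contains polynomial rings in arbitrarily many independent variables, and it has
  enough homomorphisms to view all its elements as continuous functions of these variables.
  Topology of Euclidean balls then obstructs reducibility, as it does for polynomial rings over
  the real numbers and the row \<open>(x\<^sub>1, \<dots>, x\<^sub>m, 1 - \<Sum> x\<^sub>i\<^sup>2)\<close>.

  In detail, the functions \<open>t ^ m * exp (l * t)\<close> are linearly independent (\<open>exp_poly_sum_eq_0\<close>), so
  the Bohl algebra is the group ring of the additive group \<open>\<complex>\<close> over the polynomials in \<open>t\<close>
  (\<open>to_bohl_inj\<close>, \<open>range_to_bohl\<close>). Every character \<open>\<psi>\<close> of \<open>(\<complex>, +)\<close>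
  thus gives a homomorphism to \<open>\<complex>\<close> that sends \<open>t\<close> to \<open>1\<close> and \<open>exp (l * t)\<close> to \<open>\<psi> l\<close>. Since \<open>\<complex>\<close>
  has infinite dimension over the rationals, there are exponents
  \<open>b\<^sub>0, b\<^sub>1, \<dots>\<close> whose character values can be prescribed independently as positive reals
  \<open>y\<^sub>k + 2\<close>, and the character can be chosen to depend continuously on \<open>y\<close>
  (\<open>rational_coordinates\<close>). The elements \<open>s\<^sub>k = exp (b\<^sub>k * t) - 2\<close> become the coordinates \<open>y\<^sub>k\<close> of
  a point of the unit ball in \<open>2 * n\<close> dimensions.

  Group these coordinates into \<open>n\<close> complex ones, \<open>f\<^sub>j = s\<^sub>2\<^sub>j\<^sub>-\<^sub>2 + \<i> * s\<^sub>2\<^sub>j\<^sub>-\<^sub>1\<close>. The algebra also contains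
  their conjugates, and the row completed by \<open>g = 1 - \<Sum> s\<^sub>k\<^sup>2\<close> is invertible. If it were
  reducible, the entries \<open>f\<^sub>j + a\<^sub>j * g\<close> would give a continuous map from the ball to \<open>\<complex>\<^sup>n\<close> that has no zero
  and is the identity on the sphere. No such map exists, as spheres are not contractible
  (\<open>continuous_extension_of_sphere_identity_has_zero\<close>). This applies to every \<open>n \<ge> 1\<close>
  (\<open>group_ring_unimodular_row_not_reducible\<close>).
\<close>

section \<open>A zero of every extension of the identity of the sphere\<close>

text \<open>A form of Brouwer's theorem in terms of coordinates, so that the dimension is a number and not
  a type. If \<open>G\<close> had no zero, then normalising \<open>G (t * y)\<close> for \<open>t\<close> from \<open>0\<close> to \<open>1\<close> would contract
  the sphere.\<close>

lemma continuous_extension_of_sphere_identity_has_zero: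
  fixes G :: "(nat \<Rightarrow> real) \<Rightarrow> nat \<Rightarrow> real"
  assumes cont: "\<And>i. i \<le> p \<Longrightarrow> continuous_on {y. (\<Sum>i\<le>p. (y i)\<^sup>2) \<le> 1} (\<lambda>y. G y i)"
    and sphere: "\<And>y i. (\<Sum>i\<le>p. (y i)\<^sup>2) = 1 \<Longrightarrow> i \<le> p \<Longrightarrow> G y i = y i"
  shows "\<exists>y. (\<Sum>i\<le>p. (y i)\<^sup>2) \<le> 1 \<and> (\<forall>i\<le>p. G y i = 0)"
proof (rule ccontr)
  assume "\<not> ?thesis"
  then have pos: "(\<Sum>i\<le>p. (G y i)\<^sup>2) > 0" if "(\<Sum>i\<le>p. (y i)\<^sup>2) \<le> 1" for y
    using that by (metis (no_types, lifting) atMost_iff finite_atMost less_eq_real_def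
        sum_nonneg sum_nonneg_eq_0_iff zero_eq_power2 zero_le_power2)
  define S :: "(nat \<Rightarrow> real) set" where "S = {x. (\<Sum>i\<le>p. (x i)\<^sup>2) = 1 \<and> (\<forall>i>p. x i = 0)}"
  define h where "h = (\<lambda>(t::real, y) i.
    if i \<le> p then G (\<lambda>j. t * y j) i / sqrt (\<Sum>k\<le>p. (G (\<lambda>j. t * y j) k)\<^sup>2) else 0)"
  have scale: "(\<Sum>i\<le>p. (t * y i)\<^sup>2) \<le> 1" if "t \<in> {0..1}" "y \<in> S" for t y
    using that by (simp add: S_def power_mult_distrib abs_square_le_1 flip: sum_distrib_left)
  have contG: "continuous_on ({0..1} \<times> S) (\<lambda>z. G (\<lambda>j. fst z * snd z j) i)" if "i \<le> p" for i
  proof (rule continuous_on_compose2[OF cont[OF that]])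
    show "continuous_on ({0..1} \<times> S) (\<lambda>z j. fst z * snd z j)"
    proof (rule continuous_on_coordinatewise_then_product)
      fix j
      have "continuous_on ({0..1} \<times> S) (\<lambda>z. snd z j)"
        by (rule continuous_on_product_then_coordinatewise[OF continuous_on_snd[OF continuous_on_id]])
      then show "continuous_on ({0..1} \<times> S) (\<lambda>z. fst z * snd z j)"
        by (rule continuous_on_mult[OF continuous_on_fst[OF continuous_on_id]])
    qed
    show "(\<lambda>z j. fst z * snd z j) ` ({0..1} \<times> S) \<subseteq> {y. (\<Sum>i\<le>p. (y i)\<^sup>2) \<le> 1}"
      using scale by fastforce
  qed
  have conth: "continuous_on ({0..1} \<times> S) h"
  proof (rule continuous_on_coordinatewise_then_product)
    fix i
    show "continuous_on ({0..1} \<times> S) (\<lambda>z. h z i)"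
    proof (cases "i \<le> p")
      case True
      then show ?thesis
        unfolding h_def case_prod_unfold
        using pos[OF scale] by (auto intro!: continuous_intros contG simp: less_le)
    qed (simp add: h_def case_prod_unfold)
  qed
  have him: "h z \<in> S" if "z \<in> {0..1} \<times> S" for z
  proof -
    obtain t y where z: "z = (t, y)" by fastforce
    define q where "q = (\<Sum>k\<le>p. (G (\<lambda>j. t * y j) k)\<^sup>2)"
    have "q > 0" using pos[OF scale] that z by (simp add: q_def)
    have "(\<Sum>i\<le>p. (h z i)\<^sup>2) = (\<Sum>i\<le>p. (G (\<lambda>j. t * y j) i)\<^sup>2 / q)"
      using \<open>q > 0\<close> by (intro sum.cong) (auto simp: h_def z q_def power_divide)
    also have "\<dots> = 1"
      using \<open>q > 0\<close> by (simp add: q_def flip: sum_divide_distrib)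
    finally show ?thesis by (simp add: S_def h_def z)
  qed
  have "homotopic_with_canon (\<lambda>x. True) S S (h \<circ> Pair 0) (h \<circ> Pair 1)"
    using conth him unfolding homotopic_with_def
    by (intro exI[of _ h]) (auto simp: image_subset_iff_funcset)
  then have "homotopic_with_canon (\<lambda>x. True) S S (\<lambda>x. h (0, \<lambda>_. 0)) id"
  proof (rule homotopic_with_eq)
    fix y assume "y \<in> topspace (top_of_set S)"
    then show "id y = (h \<circ> Pair 1) y"
      by (auto simp: h_def S_def sphere fun_eq_iff)
  qed (auto simp: h_def)
  then have "contractible S"
    unfolding contractible_def using homotopic_with_sym by blast
  moreover have "nsphere p = top_of_set S"
    by (simp add: nsphere S_def euclidean_product_topology)
  ultimately show False
    using non_contractible_space_nsphere[of p] by simp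
qed

section \<open>Rational coordinates on the complex numbers\<close>

lemma countable_rational_span:
  assumes "finite B"
  shows "countable (module.span (\<lambda>q z. of_rat q * z :: complex) B)"
proof -
  interpret Q: vector_space "\<lambda>q z. of_rat q * z :: complex"
    by unfold_locales (auto simp: algebra_simps of_rat_add of_rat_mult)
  show ?thesis
    using assms
  proof (induction B rule: finite_induct)
    case (insert b B)
    have "Q.span (insert b B) \<subseteq> (\<lambda>(q, z). of_rat q * b + z) ` (UNIV \<times> Q.span B)"
    proof
      fix z assume "z \<in> Q.span (insert b B)"
      then obtain q where "z - of_rat q * b \<in> Q.span B"
        by (auto simp: Q.span_insert)
      then show "z \<in> (\<lambda>(q, z). of_rat q * b + z) ` (UNIV \<times> Q.span B)"
        by (intro image_eqI[of _ _ "(q, z - of_rat q * b)"]) auto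
    qed
    then show ?case
      using insert.IH by (meson countable_SIGMA countable_image countable_subset uncountable_def countableI_type)
  qed simp
qed

text \<open>A basis of \<open>\<complex>\<close> over the rationals is infinite, because finitely many vectors have a
  countable rational span. Coordinates with respect to infinitely many of its members are the
  additive functionals below; they extend to all exponents, which matters because the exponents
  of an unknown element of the Bohl algebra are arbitrary.\<close>

lemma rational_coordinates:
  obtains b :: "nat \<Rightarrow> complex" and \<phi> :: "nat \<Rightarrow> complex \<Rightarrow> real"
  where "\<And>k z w. \<phi> k (z + w) = \<phi> k z + \<phi> k w"
    and "\<And>j k. \<phi> k (b j) = (if j = k then 1 else 0)"
proof -
  interpret Q: vector_space "\<lambda>q z. of_rat q * z :: complex"
    by unfold_locales (auto simp: algebra_simps of_rat_add of_rat_mult)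
  obtain H where "Q.independent H" "UNIV \<subseteq> Q.span H"
    by (rule Q.basis_exists[of UNIV])
  then have H: "Q.independent H" "Q.span H = UNIV" by auto
  have "\<not> countable (UNIV :: complex set)"
    using uncountable_UNIV_complex by simp
  then have "infinite H"
    using countable_rational_span[of H] H(2) by auto
  then obtain b :: "nat \<Rightarrow> complex" where b: "inj b" "range b \<subseteq> H"
    using infinite_countable_subset by blast
  show thesis
  proof
    show "real_of_rat (Q.representation H (z + w) (b k)) =
        real_of_rat (Q.representation H z (b k)) + real_of_rat (Q.representation H w (b k))" for k z w
      using H by (simp add: Q.representation_add of_rat_add)
    show "real_of_rat (Q.representation H (b j) (b k)) = (if j = k then 1 else 0)" for j k
      using b by (subst Q.representation_basis[OF H(1)]) (auto simp: inj_def)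
  qed
qed

section \<open>Linear independence of exponential monomials\<close>

lemma exp_poly_has_vector_derivative:
  fixes p :: "complex poly"
  shows "((\<lambda>t. poly p (of_real t) * exp (l * of_real t)) has_vector_derivative
      poly (pderiv p + smult l p) (of_real t) * exp (l * of_real t)) (at t)"
proof -
  have "((\<lambda>z. poly p z * exp (l * z)) has_field_derivative
      poly (pderiv p + smult l p) (of_real t) * exp (l * of_real t)) (at (of_real t))"
    by (auto intro!: derivative_eq_intros simp: algebra_simps)
  from has_vector_derivative_real_field[OF this] show ?thesis by simp
qed

text \<open>The derivative has smaller degree, so it cannot cancel the leading coefficient of
  \<open>smult c p\<close>.\<close>

lemma pderiv_add_smult_eq_0_iff:
  fixes p :: "'a::idom poly"
  assumes "c \<noteq> 0"
  shows "pderiv p + smult c p = 0 \<longleftrightarrow> p = 0"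
proof
  assume eq: "pderiv p + smult c p = 0"
  have "c * lead_coeff p = coeff (pderiv p + smult c p) (degree p)"
    by (simp add: coeff_pderiv coeff_eq_0)
  then show "p = 0" using eq assms by simp
qed simp

text \<open>Single out one exponent \<open>a\<close> and apply the operator \<open>d/dt - a\<close>: it differentiates the
  coefficient of \<open>exp (a * t)\<close>, and on every other coefficient it acts injectively. Repetition
  kills the coefficient at \<open>a\<close> and leaves a relation with fewer exponents.\<close>

lemma exp_poly_sum_eq_0:
  fixes p :: "complex \<Rightarrow> complex poly"
  assumes "finite A"
    and "\<And>t::real. (\<Sum>l\<in>A. poly (p l) (of_real t) * exp (l * of_real t)) = 0"
  shows "\<forall>l\<in>A. p l = 0"
  using assms
proof (induction A arbitrary: p rule: finite_induct)
  case (insert a A)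
  note outer = insert.IH
  have "\<forall>l\<in>insert a A. p l = 0"
    using insert.prems
  proof (induction "degree (p a)" arbitrary: p rule: less_induct)
    case less
    \<comment> \<open>The coefficients after the operator \<open>d/dt - a\<close>.\<close>
    define D where "D l = pderiv (p l) + smult (l - a) (p l)" for l
    have Da: "D a = pderiv (p a)" by (simp add: D_def)
    have sumD: "(\<Sum>l\<in>insert a A. poly (D l) (of_real t) * exp (l * of_real t)) = 0" for t :: real
    proof -
      have deriv: "((\<lambda>t::real. \<Sum>l\<in>insert a A. poly (p l) (of_real t) * exp (l * of_real t))
          has_vector_derivative (\<Sum>l\<in>insert a A.
            poly (pderiv (p l) + smult l (p l)) (of_real t) * exp (l * of_real t))) (at t)"
        by (intro has_vector_derivative_sum exp_poly_has_vector_derivative)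
      have "(\<Sum>l\<in>insert a A.
          poly (pderiv (p l) + smult l (p l)) (of_real t) * exp (l * of_real t)) = 0"
        using vector_derivative_at[OF deriv] unfolding less.prems vector_derivative_const_at
        by (rule sym)
      moreover have "(\<Sum>l\<in>insert a A. poly (D l) (of_real t) * exp (l * of_real t)) =
          (\<Sum>l\<in>insert a A. poly (pderiv (p l) + smult l (p l)) (of_real t) * exp (l * of_real t))
          - a * (\<Sum>l\<in>insert a A. poly (p l) (of_real t) * exp (l * of_real t))"
        unfolding sum_distrib_left sum_subtractf[symmetric]
        by (intro sum.cong) (auto simp: D_def algebra_simps)
      ultimately show ?thesis using less.prems by simp
    qed
    have pa: "pderiv (p a) = 0"
    proof (cases "degree (p a) = 0")
      case False
      then have "degree (D a) < degree (p a)" by (simp add: Da degree_pderiv)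
      from less.hyps[OF this sumD] show ?thesis by (simp add: Da)
    qed (simp add: pderiv_eq_0_iff)
    then have "(\<Sum>l\<in>A. poly (D l) (of_real t) * exp (l * of_real t)) = 0" for t :: real
      using sumD[of t] insert.hyps by (simp add: Da)
    then have "\<forall>l\<in>A. D l = 0" by (rule outer)
    then have A: "\<forall>l\<in>A. p l = 0"
      using insert.hyps pderiv_add_smult_eq_0_iff unfolding D_def
      by (metis eq_iff_diff_eq_0)
    then have "poly (p a) (of_real t) = 0" for t :: real
      using less.prems[of t] insert.hyps by simp
    moreover have "p a = [:coeff (p a) 0:]"
      using pa by (metis pderiv_eq_0_iff degree_eq_zeroE coeff_pCons_0)
    ultimately have "p a = 0"
      by (metis mult_zero_right pCons_0_0 poly_0 poly_pCons add.right_neutral of_real_0)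
    with A show ?case by simp
  qed
  then show ?case .
qed simp

section \<open>Exponential polynomials as a group ring\<close>

text \<open>The ring \<open>'a \<Rightarrow>\<^sub>0 'b poly\<close> is the monoid ring of the exponents \<open>l\<close> with coefficients in the
  polynomial ring. A number \<open>s\<close> to substitute into the coefficients and a character
  \<open>\<psi>\<close> of the exponents together determine a homomorphism to the scalars.\<close>

definition group_ring_eval :: "'b::comm_ring_1 \<Rightarrow> ('a \<Rightarrow> 'b) \<Rightarrow> ('a \<Rightarrow>\<^sub>0 'b poly) \<Rightarrow> 'b"
  where "group_ring_eval s \<psi> P =
    (\<Sum>l\<in>Poly_Mapping.keys P. poly (Poly_Mapping.lookup P l) s * \<psi> l)"

lemma group_ring_eval_superset:
  assumes "finite A" "Poly_Mapping.keys P \<subseteq> A"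
  shows "group_ring_eval s \<psi> P = (\<Sum>l\<in>A. poly (Poly_Mapping.lookup P l) s * \<psi> l)"
  unfolding group_ring_eval_def using assms
  by (intro sum.mono_neutral_left) (auto simp: in_keys_iff)

lemma group_ring_eval_single:
  "group_ring_eval s \<psi> (Poly_Mapping.single l p) = poly p s * \<psi> l"
  by (subst group_ring_eval_superset[of "{l}"]) auto

lemma group_ring_eval_add:
  "group_ring_eval s \<psi> (P + Q) = group_ring_eval s \<psi> P + group_ring_eval s \<psi> Q"
proof -
  let ?A = "Poly_Mapping.keys P \<union> Poly_Mapping.keys Q"
  show ?thesis
    using Poly_Mapping.keys_add[of P Q]
    by (subst (1 2 3) group_ring_eval_superset[of ?A])
      (auto simp: lookup_add algebra_simps sum.distrib)
qed

lemma group_ring_eval_0: "group_ring_eval s \<psi> 0 = 0"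
  by (simp add: group_ring_eval_def)

lemma group_ring_eval_sum:
  "group_ring_eval s \<psi> (\<Sum>i\<in>A. P i) = (\<Sum>i\<in>A. group_ring_eval s \<psi> (P i))"
  by (induction A rule: infinite_finite_induct)
    (simp_all add: group_ring_eval_0 group_ring_eval_add)

lemma group_ring_eval_diff:
  "group_ring_eval s \<psi> (P - Q) = group_ring_eval s \<psi> P - group_ring_eval s \<psi> Q"
  using group_ring_eval_add[of s \<psi> "P - Q" Q] by simp

lemma poly_mapping_sum_single:
  "P = (\<Sum>l\<in>Poly_Mapping.keys P. Poly_Mapping.single l (Poly_Mapping.lookup P l))"
  by (rule poly_mapping_eqI)
    (auto simp: lookup_sum lookup_single when_def in_keys_iff sum.delta)

lemma group_ring_eval_mult:
  fixes \<psi> :: "'a::monoid_add \<Rightarrow> 'b::comm_ring_1"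
  assumes "\<And>k l. \<psi> (k + l) = \<psi> k * \<psi> l"
  shows "group_ring_eval s \<psi> (P * Q) = group_ring_eval s \<psi> P * group_ring_eval s \<psi> Q"
proof -
  have "group_ring_eval s \<psi> (P * Q) = (\<Sum>k\<in>Poly_Mapping.keys P. \<Sum>l\<in>Poly_Mapping.keys Q.
      group_ring_eval s \<psi> (Poly_Mapping.single k (Poly_Mapping.lookup P k) *
        Poly_Mapping.single l (Poly_Mapping.lookup Q l)))"
    by (subst (1) poly_mapping_sum_single[of P], subst (1) poly_mapping_sum_single[of Q])
      (simp add: sum_product group_ring_eval_sum)
  also have "\<dots> = (\<Sum>k\<in>Poly_Mapping.keys P. \<Sum>l\<in>Poly_Mapping.keys Q.
      (poly (Poly_Mapping.lookup P k) s * \<psi> k) * (poly (Poly_Mapping.lookup Q l) s * \<psi> l))"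
    by (simp only: mult_single group_ring_eval_single assms poly_mult mult_ac)
  also have "\<dots> = group_ring_eval s \<psi> P * group_ring_eval s \<psi> Q"
    by (simp add: sum_product group_ring_eval_def)
  finally show ?thesis .
qed

lemma group_ring_eval_1: "\<psi> 0 = 1 \<Longrightarrow> group_ring_eval s \<psi> 1 = 1"
  using group_ring_eval_single[of s \<psi> 0 1] by simp

text \<open>Elements of the group ring are formal exponential polynomials, which makes the exponents
  and coefficients of an element available for substitution.\<close>

definition to_bohl :: "(complex \<Rightarrow>\<^sub>0 complex poly) \<Rightarrow> real \<Rightarrow> complex"
  where "to_bohl P t = group_ring_eval (of_real t) (\<lambda>l. exp (l * of_real t)) P"

lemma to_bohl_single: "to_bohl (Poly_Mapping.single l p) = (\<lambda>t. poly p (of_real t) * exp (l * of_real t))"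
  by (simp add: fun_eq_iff to_bohl_def group_ring_eval_single)

lemma to_bohl_add: "to_bohl (P + Q) = (\<lambda>t. to_bohl P t + to_bohl Q t)"
  by (simp add: fun_eq_iff to_bohl_def group_ring_eval_add)

lemma to_bohl_sum: "to_bohl (\<Sum>i\<in>A. P i) = (\<lambda>t. \<Sum>i\<in>A. to_bohl (P i) t)"
  by (simp add: fun_eq_iff to_bohl_def group_ring_eval_sum)

lemma to_bohl_mult: "to_bohl (P * Q) = (\<lambda>t. to_bohl P t * to_bohl Q t)"
  by (simp add: fun_eq_iff to_bohl_def group_ring_eval_mult exp_add algebra_simps)

lemma to_bohl_1: "to_bohl 1 = (\<lambda>t. 1)"
  by (simp add: fun_eq_iff to_bohl_def group_ring_eval_1)

text \<open>Thanks to this, an identity between functions of the real variable is an identity of formal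
  expressions, to which the evaluations at other characters apply.\<close>

lemma to_bohl_inj: 
  assumes "to_bohl P = to_bohl Q"
  shows "P = Q"
proof -
  have "to_bohl (P - Q) t = 0" for t
    using assms by (simp add: fun_eq_iff to_bohl_def group_ring_eval_diff fun_eq_iff)
  then have "\<forall>l\<in>Poly_Mapping.keys (P - Q). Poly_Mapping.lookup (P - Q) l = 0"
    unfolding to_bohl_def group_ring_eval_def
    by (intro exp_poly_sum_eq_0) auto
  then have "P - Q = 0"
    by (metis in_keys_iff lookup_zero poly_mapping_eqI)
  then show ?thesis by simp
qed

lemma range_to_bohl: "range to_bohl = bohl_functions"
proof (intro equalityI subsetI)
  fix f assume "f \<in> range to_bohl"
  then obtain P where f: "f = to_bohl P" by blast
  have "f = (\<lambda>t. \<Sum>l\<in>Poly_Mapping.keys P. \<Sum>i\<le>degree (Poly_Mapping.lookup P l).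
      coeff (Poly_Mapping.lookup P l) i * of_real t ^ i * exp (l * of_real t))"
    unfolding f to_bohl_def group_ring_eval_def poly_altdef sum_distrib_right ..
  then show "f \<in> bohl_functions"
    by (simp add: bohl_functions_sum bohl_functions_monomial)
next
  fix f assume "f \<in> bohl_functions"
  then obtain N :: nat and c m l where
    "f = (\<lambda>t. \<Sum>n=1..N. c n * of_real t ^ m n * exp (l n * of_real t))"
    by (rule bohl_functionsE)
  then have "f = to_bohl (\<Sum>n=1..N. Poly_Mapping.single (l n) (monom (c n) (m n)))"
    by (simp add: to_bohl_sum to_bohl_single poly_monom)
  then show "f \<in> range to_bohl" by blast
qed

section \<open>Irreducible unimodular rows in the group ring\<close>

lemma sum_even_odd_pairs:
  fixes h :: "nat \<Rightarrow> 'a::comm_monoid_add"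
  shows "(\<Sum>j=1..n. h (2 * j - 2) + h (2 * j - 1)) = (\<Sum>k<2 * n. h k)"
  by (induction n) (auto simp: algebra_simps)

text \<open>With \<open>2 * n\<close> independent exponents \<open>b k\<close>, the elements \<open>s k\<close> (a shifted exponential) are
  independent variables, and the evaluation at a point \<open>y\<close> of the unit ball sends \<open>s k\<close> to the
  coordinate \<open>y k\<close>. The entries \<open>f j\<close> are the complex coordinates of the ball, the entries \<open>f' j\<close>
  their conjugates, and \<open>g\<close> is \<open>1\<close> minus the squared norm. A reduction \<open>f j + a j * g\<close> is a
  continuous vector field on the ball which is the identity on the sphere, where \<open>g\<close> vanishes.
  It therefore has a zero, where every combination of its components vanishes.\<close>

lemma group_ring_unimodular_row_not_reducible:
  assumes "n \<ge> 1"
  obtains f f' :: "nat \<Rightarrow> complex \<Rightarrow>\<^sub>0 complex poly" and g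
  where "(\<Sum>j=1..n. f' j * f j) + g = 1"
    and "\<And>a x. (\<Sum>j=1..n. x j * (f j + a j * g)) \<noteq> 1"
proof -
  obtain b :: "nat \<Rightarrow> complex" and \<phi> :: "nat \<Rightarrow> complex \<Rightarrow> real"
    where \<phi>_add: "\<And>k z w. \<phi> k (z + w) = \<phi> k z + \<phi> k w"
      and \<phi>_b: "\<And>j k. \<phi> k (b j) = (if j = k then 1 else 0)"
    by (rule rational_coordinates) (rule that)
  \<comment> \<open>The characters below have positive values, so \<open>exp (b k * t)\<close> is shifted by \<open>2\<close> to let
    \<open>s k\<close> take all values in \<open>[-1, 1]\<close>.\<close>
  define s where "s k = Poly_Mapping.single (b k) 1 - Poly_Mapping.single 0 [:2::complex:]" for k
  define I where "I = Poly_Mapping.single (0::complex) [:\<i>:]"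
  define f where "f j = s (2 * j - 2) + I * s (2 * j - 1)" for j
  define f' where "f' j = s (2 * j - 2) - I * s (2 * j - 1)" for j
  define g where "g = 1 - (\<Sum>j=1..n. f' j * f j)"
  \<comment> \<open>The product of the powers \<open>(y k + 2) powr \<phi> k l\<close>: a character because each \<open>\<phi> k\<close> is
    additive, with the value \<open>y k + 2\<close> at \<open>b k\<close>.\<close>
  define \<psi> :: "(nat \<Rightarrow> real) \<Rightarrow> complex \<Rightarrow> complex"
    where "\<psi> y l = exp (of_real (\<Sum>k<2 * n. \<phi> k l * ln (y k + 2)))" for y l
  \<comment> \<open>Any number may be substituted for \<open>t\<close>; the choice here is \<open>1\<close>.\<close>
  define ev where "ev y = group_ring_eval 1 (\<psi> y)" for y
  define D where "D = {y :: nat \<Rightarrow> real. (\<Sum>k\<le>2 * n - 1. (y k)\<^sup>2) \<le> 1}"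
  have upto: "{..2 * n - 1} = {..<2 * n}" using assms by auto
  have \<psi>_add: "\<psi> y (k + l) = \<psi> y k * \<psi> y l" for y k l
    by (simp add: \<psi>_def \<phi>_add distrib_right sum.distrib exp_add)
  have \<phi>_0: "\<phi> k 0 = 0" for k
    using \<phi>_add[of k 0 0] by simp
  have ev_simps [simp]: "ev y (P + Q) = ev y P + ev y Q" "ev y (P - Q) = ev y P - ev y Q"
    "ev y (P * Q) = ev y P * ev y Q" "ev y (sum R A) = (\<Sum>i\<in>A. ev y (R i))" "ev y 1 = 1"
    "ev y (Poly_Mapping.single l p) = poly p 1 * \<psi> y l"
    for y P Q l p A and R :: "nat \<Rightarrow> _"
    by (simp_all add: ev_def group_ring_eval_add group_ring_eval_diff group_ring_eval_sum
        group_ring_eval_single group_ring_eval_mult[OF \<psi>_add] group_ring_eval_1 \<psi>_def[of _ 0] \<phi>_0)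
  have less2: "y k + 2 > 0" if "y \<in> D" "k < 2 * n" for y k
  proof -
    have "(y k)\<^sup>2 \<le> (\<Sum>k\<le>2 * n - 1. (y k)\<^sup>2)"
      using that by (intro member_le_sum) (auto simp: upto)
    also have "\<dots> \<le> 1" using that by (simp add: D_def)
    finally have "\<bar>y k\<bar> \<le> 1" by (simp add: abs_square_le_1)
    then show ?thesis by linarith
  qed
  have ev_s: "ev y (s k) = of_real (y k)" if "y \<in> D" "k < 2 * n" for y k
  proof -
    have "(\<Sum>i<2 * n. \<phi> i (b k) * ln (y i + 2)) = (\<Sum>i<2 * n. if i = k then ln (y k + 2) else 0)"
      by (intro sum.cong) (auto simp: \<phi>_b)
    also have "\<dots> = ln (y k + 2)" using that by simp
    finally have "\<psi> y (b k) = of_real (y k + 2)"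
      using less2[OF that] by (simp add: \<psi>_def exp_of_real)
    then show ?thesis by (simp add: s_def \<psi>_def[of _ 0] \<phi>_0)
  qed
  have ev_I: "ev y I = \<i>" for y by (simp add: I_def \<psi>_def \<phi>_0)
  have ev_f: "ev y (f j) = Complex (y (2 * j - 2)) (y (2 * j - 1))"
    and ev_f': "ev y (f' j) = Complex (y (2 * j - 2)) (- y (2 * j - 1))"
    if "y \<in> D" "j \<in> {1..n}" for y j
    using that by (auto simp: f_def f'_def ev_s ev_I complex_eq_iff)
  have ev_g: "ev y g = of_real (1 - (\<Sum>k\<le>2 * n - 1. (y k)\<^sup>2))" if "y \<in> D" for y
  proof -
    have "(\<Sum>j=1..n. ev y (f' j) * ev y (f j)) =
        (\<Sum>j=1..n. of_real ((y (2 * j - 2))\<^sup>2) + of_real ((y (2 * j - 1))\<^sup>2))"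
      using that by (intro sum.cong)
        (auto simp: ev_f ev_f' complex_eq_iff power2_eq_square)
    also have "\<dots> = of_real (\<Sum>k\<le>2 * n - 1. (y k)\<^sup>2)"
      unfolding upto using sum_even_odd_pairs[of "\<lambda>k. complex_of_real ((y k)\<^sup>2)" n] by simp
    finally show ?thesis by (simp add: g_def)
  qed
  have cont: "continuous_on D (\<lambda>y. ev y P)" for P
    unfolding ev_def group_ring_eval_def \<psi>_def
    by (intro continuous_intros continuous_on_product_then_coordinatewise[OF continuous_on_id])
      (use less2 in force)
  show thesis
  proof
    show "(\<Sum>j=1..n. f' j * f j) + g = 1" by (simp add: g_def)
    fix a x
    show "(\<Sum>j=1..n. x j * (f j + a j * g)) \<noteq> 1"
    proof
      assume eq: "(\<Sum>j=1..n. x j * (f j + a j * g)) = 1"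
      define W where "W y j = ev y (f j + a j * g)" for y j
      \<comment> \<open>The complex vector \<open>W y\<close> written in real coordinates, numbered from \<open>0\<close>.\<close>
      define G where "G y i = (if even i then Re (W y (i div 2 + 1)) else Im (W y (i div 2 + 1)))"
        for y i
      have "\<exists>y. (\<Sum>i\<le>2 * n - 1. (y i)\<^sup>2) \<le> 1 \<and> (\<forall>i\<le>2 * n - 1. G y i = 0)"
      proof (rule continuous_extension_of_sphere_identity_has_zero)
        fix i assume "i \<le> 2 * n - 1"
        have "continuous_on D (\<lambda>y. G y i)"
          unfolding G_def W_def by (cases "even i") (auto simp del: ev_simps intro!: continuous_intros cont)
        then show "continuous_on {y. (\<Sum>i\<le>2 * n - 1. (y i)\<^sup>2) \<le> 1} (\<lambda>y. G y i)"
          by (simp add: D_def)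
      next
        fix y :: "nat \<Rightarrow> real" and i
        assume y: "(\<Sum>i\<le>2 * n - 1. (y i)\<^sup>2) = 1" and i: "i \<le> 2 * n - 1"
        have "y \<in> D" using y by (simp add: D_def)
        moreover have "i div 2 + 1 \<in> {1..n}" using i assms by auto
        ultimately have "W y (i div 2 + 1) = Complex (y (2 * (i div 2))) (y (2 * (i div 2) + 1))"
          using y by (simp add: W_def ev_f ev_g)
        then show "G y i = y i"
          by (cases "even i") (auto simp: G_def)
      qed
      then obtain y where G0: "\<forall>i\<le>2 * n - 1. G y i = 0" by blast
      have "W y j = 0" if "j \<in> {1..n}" for j
      proof -
        have "G y (2 * j - 2) = 0" "G y (2 * j - 1) = 0" using G0 that by auto
        moreover have "2 * j - 2 = 2 * (j - 1)" "2 * j - 1 = 2 * (j - 1) + 1" "j - 1 + 1 = j"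
          using that by auto
        ultimately show ?thesis by (simp add: G_def complex_eq_iff)
      qed
      then have "ev y (\<Sum>j=1..n. x j * (f j + a j * g)) = 0"
        by (simp add: W_def)
      with eq show False by simp
    qed
  qed
qed

section \<open>The Bass stable rank\<close>

lemma finsum_bohl_algebra:
  assumes "\<And>j. j \<in> A \<Longrightarrow> h j \<in> bohl_functions" "finite A"
  shows "(\<Oplus>\<^bsub>bohl_algebra\<^esub>j\<in>A. h j) = (\<lambda>t. \<Sum>j\<in>A. h j t)"
proof -
  interpret cring bohl_algebra by (rule cring_bohl_algebra)
  from assms(2,1) show ?thesis
  proof (induction A rule: finite_induct)
    case empty
    have "\<zero>\<^bsub>bohl_algebra\<^esub> = (\<lambda>t. 0)" by (simp add: bohl_algebra_def)
    then show ?case by simp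
  next
    case (insert a A)
    then have "(\<Oplus>\<^bsub>bohl_algebra\<^esub>j\<in>insert a A. h j) = h a \<oplus>\<^bsub>bohl_algebra\<^esub> (\<Oplus>\<^bsub>bohl_algebra\<^esub>j\<in>A. h j)"
      by (intro finsum_insert) (auto simp: bohl_algebra_def)
    with insert show ?case by (simp add: bohl_algebra_def)
  qed
qed

lemma tuples_bohl_algebra_lift:
  assumes "x \<in> tuples bohl_algebra n"
  obtains X where "\<And>j. j \<in> {1..n} \<Longrightarrow> x j = to_bohl (X j)"
proof -
  have "\<forall>j\<in>{1..n}. \<exists>P. x j = to_bohl P"
    using assms range_to_bohl by (auto simp: tuples_def bohl_algebra_def PiE_iff)
  then show thesis using that by metis
qed

lemma to_bohl_in_bohl_functions: "to_bohl P \<in> bohl_functions"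
  using range_to_bohl by blast

text \<open>Since \<open>to_bohl\<close> is an isomorphism, invertibility of a tuple can be decided among formal
  exponential polynomials.\<close>

lemma invertible_tuples_bohl_algebra_iff:
  "(\<lambda>j\<in>{1..n}. to_bohl (F j)) \<in> invertible_tuples bohl_algebra n \<longleftrightarrow>
    (\<exists>X. (\<Sum>j=1..n. X j * F j) = 1)"
proof -
  let ?f = "\<lambda>j\<in>{1..n}. to_bohl (F j)"
  have sum_eq: "(\<Oplus>\<^bsub>bohl_algebra\<^esub>j\<in>{1..n}. x j \<otimes>\<^bsub>bohl_algebra\<^esub> ?f j) = to_bohl (\<Sum>j=1..n. X j * F j)"
    if "\<And>j. j \<in> {1..n} \<Longrightarrow> x j = to_bohl (X j)" for x X
  proof -
    have "x j \<otimes>\<^bsub>bohl_algebra\<^esub> ?f j = to_bohl (X j * F j)" if "j \<in> {1..n}" for j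
      using that \<open>\<And>j. j \<in> {1..n} \<Longrightarrow> x j = to_bohl (X j)\<close> by (simp add: bohl_algebra_def to_bohl_mult)
    then show ?thesis
      by (subst finsum_bohl_algebra) (auto simp: to_bohl_in_bohl_functions to_bohl_sum)
  qed
  have one: "\<one>\<^bsub>bohl_algebra\<^esub> = to_bohl 1" by (simp add: bohl_algebra_def to_bohl_1)
  show ?thesis
  proof
    assume "?f \<in> invertible_tuples bohl_algebra n"
    then obtain x where x: "x \<in> tuples bohl_algebra n"
        "(\<Oplus>\<^bsub>bohl_algebra\<^esub>j\<in>{1..n}. x j \<otimes>\<^bsub>bohl_algebra\<^esub> ?f j) = \<one>\<^bsub>bohl_algebra\<^esub>"
      unfolding invertible_tuples_def by blast
    obtain X where X: "\<And>j. j \<in> {1..n} \<Longrightarrow> x j = to_bohl (X j)"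
      using tuples_bohl_algebra_lift[OF x(1)] by blast
    from sum_eq[OF X] x(2) have "to_bohl (\<Sum>j=1..n. X j * F j) = to_bohl 1"
      unfolding one by (rule trans[OF sym])
    then show "\<exists>X. (\<Sum>j=1..n. X j * F j) = 1" using to_bohl_inj by blast
  next
    assume "\<exists>X. (\<Sum>j=1..n. X j * F j) = 1"
    then obtain X where X: "(\<Sum>j=1..n. X j * F j) = 1" by blast
    have tup: "(\<lambda>j\<in>{1..n}. to_bohl (Y j)) \<in> tuples bohl_algebra n" for Y
      by (auto simp: tuples_def bohl_algebra_def to_bohl_in_bohl_functions)
    have "(\<Oplus>\<^bsub>bohl_algebra\<^esub>j\<in>{1..n}. (\<lambda>j\<in>{1..n}. to_bohl (X j)) j \<otimes>\<^bsub>bohl_algebra\<^esub> ?f j) = \<one>\<^bsub>bohl_algebra\<^esub>"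
      using sum_eq[of "\<lambda>j\<in>{1..n}. to_bohl (X j)" X] X one by simp
    then show "?f \<in> invertible_tuples bohl_algebra n"
      using tup unfolding invertible_tuples_def by blast
  qed
qed

lemma not_stable_at_bohl_algebra:
  assumes "n \<ge> 1"
  shows "\<not> stable_at bohl_algebra n"
proof
  assume stable: "stable_at bohl_algebra n"
  obtain f f' :: "nat \<Rightarrow> complex \<Rightarrow>\<^sub>0 complex poly" and g
    where unimodular: "(\<Sum>j=1..n. f' j * f j) + g = 1"
      and irreducible: "\<And>a x. (\<Sum>j=1..n. x j * (f j + a j * g)) \<noteq> 1"
    by (rule group_ring_unimodular_row_not_reducible[OF assms]) (rule that)
  define F where "F = f(Suc n := g)"
  have "(\<Sum>j=1..Suc n. (f'(Suc n := 1)) j * F j) = 1"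
    using unimodular by (simp add: F_def)
  then have "(\<lambda>j\<in>{1..Suc n}. to_bohl (F j)) \<in> invertible_tuples bohl_algebra (Suc n)"
    unfolding invertible_tuples_bohl_algebra_iff by blast
  then have "reducible_tuple bohl_algebra n (\<lambda>j\<in>{1..Suc n}. to_bohl (F j))"
    using stable by (simp add: stable_at_def)
  then obtain a where a: "a \<in> tuples bohl_algebra n"
    and inv: "(\<lambda>j\<in>{1..n}. (\<lambda>j\<in>{1..Suc n}. to_bohl (F j)) j \<oplus>\<^bsub>bohl_algebra\<^esub>
      a j \<otimes>\<^bsub>bohl_algebra\<^esub> (\<lambda>j\<in>{1..Suc n}. to_bohl (F j)) (Suc n)) \<in> invertible_tuples bohl_algebra n"
    unfolding reducible_tuple_def by blast
  obtain A where A: "\<And>j. j \<in> {1..n} \<Longrightarrow> a j = to_bohl (A j)"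
    using tuples_bohl_algebra_lift[OF a] by blast
  have eq: "(\<lambda>j\<in>{1..n}. (\<lambda>j\<in>{1..Suc n}. to_bohl (F j)) j \<oplus>\<^bsub>bohl_algebra\<^esub>
      a j \<otimes>\<^bsub>bohl_algebra\<^esub> (\<lambda>j\<in>{1..Suc n}. to_bohl (F j)) (Suc n)) =
      (\<lambda>j\<in>{1..n}. to_bohl (f j + A j * g))"
    by (intro restrict_ext) (auto simp: A F_def bohl_algebra_def to_bohl_add to_bohl_mult)
  obtain x where "(\<Sum>j=1..n. x j * (f j + A j * g)) = 1"
    using inv unfolding eq invertible_tuples_bohl_algebra_iff by (rule exE)
  with irreducible[of x A] show False by contradiction
qed

theorem theorem1p3:
  shows "bass_stable_rank bohl_algebra = \<infinity>"
  using not_stable_at_bohl_algebra by (auto simp: bass_stable_rank_def)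

end
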